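(* Let $0<q<1$ and let $b$ be a positive integer. For every $s\in\mathbb{C}$ with $\Re(s)>b$, the function $G_q^{(0,b)}(s)$ (defined below) satisfies \[ G_q^{(0,b)}(s)=\zeta_q(s). \]
   Context: Fix $0<q<1$ and for a positive integer $m$ put $[m]_q=\frac{1-q^m}{1-q}$. The $q$-multiple zeta function is \[ \zeta_q(s_1,\ldots,s_r)=\sum_{0<n_1<\cdots<n_r}\prod_{j=1}^r\frac{q^{(s_j-1)n_j}}{[n_j]_q^{s_j}},\qquad s_j\in\mathbb{C}, \] absolutely convergent on $\{\Re(s_{r-k+1}+\cdots+s_r)>k,\ k=1,\ldots,r\}$ and extended to $\mathbb{C}^r$ by meromorphic continuation. For a non-negative integer $a$, a positive integer $b$, and complex $s_1,\ldots,s_a,s$ with $\Re(s)>b$ and $\Re(s+s_{a-k+1}+\cdots+s_a)>k+b$ for $k=1,\ldots,a$, define inductively \[ G_q^{(a,1)}(s_1,\ldots,s_a;s)=\zeta_q(s_1,\ldots,s_a,s), \] \[ G_q^{(a,b)}(s_1,\ldots,s_a;s)=\sum_{n=0}^\infty G_q^{(a+1,b-1)}(s_1,\ldots,s_a,s-n-b;\,n+b)-\sum_{n=0}^\infty G_q^{(a+1,b-1)}(s_1,\ldots,s_a,-n;\,s+n)\quad(b\ge 2). \] Thus $G_q^{(0,b)}(s)$ is the case $a=0$ (no variables before the semicolon). *)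

theory Defs
  imports "HOL-Analysis.Analysis"
begin

definition q_int :: "real \<Rightarrow> nat \<Rightarrow> real" where
  "q_int q m = (1 - q ^ m) / (1 - q)"

text \<open>The variables \<open>s\<^sub>1, \<dots>, s\<^sub>r\<close> form a list, so the depth \<open>r\<close> is its length; the condition
  \<open>sorted_wrt (<) (0 # ns)\<close> says \<open>0 < n\<^sub>1 < \<dots> < n\<^sub>r\<close>. The series represents the
  \<open>q\<close>-multiple zeta function on its region of absolute convergence
  \<open>Re (s\<^bsub>r-k+1\<^esub> + \<dots> + s\<^sub>r) > k\<close> for \<open>1 \<le> k \<le> r\<close>. The continuation is not needed below,
  because only values in this region enter \<open>G_q\<close> on its domain.\<close>

definition zeta_q :: "real \<Rightarrow> complex list \<Rightarrow> complex" where
  "zeta_q q ss =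
     (\<Sum>\<^sub>\<infinity>ns\<in>{ns :: nat list. length ns = length ss \<and> sorted_wrt (<) (0 # ns)}.
        \<Prod>j<length ss.
          complex_of_real q powr ((ss ! j - 1) * of_nat (ns ! j)) /
          complex_of_real (q_int q (ns ! j)) powr (ss ! j))"

text \<open>\<open>G_q q b [s\<^sub>1, \<dots>, s\<^sub>a] s\<close> is \<open>G\<^sub>q\<^bsup>(a,b)\<^esup>(s\<^sub>1, \<dots>, s\<^sub>a; s)\<close>; \<open>a\<close> is the length of the list
  and the index \<open>b \<ge> 2\<close> of the recursion is \<open>Suc (Suc c)\<close>. It is meaningful for
  \<open>Re s > b\<close> and \<open>Re (s + s\<^bsub>a-k+1\<^esub> + \<dots> + s\<^sub>a) > k + b\<close>, \<open>1 \<le> k \<le> a\<close>. The recursive calls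
  stay inside these domains, and for \<open>b = 1\<close> the domain is exactly the region of
  absolute convergence of the series \<open>zeta_q\<close> in depth \<open>a + 1\<close>. The value for \<open>b = 0\<close> is
  left unspecified.\<close>

fun G_q :: "real \<Rightarrow> nat \<Rightarrow> complex list \<Rightarrow> complex \<Rightarrow> complex" where
  "G_q q (Suc 0) ss s = zeta_q q (ss @ [s])"
| "G_q q (Suc (Suc c)) ss s =
     (\<Sum>n. G_q q (Suc c) (ss @ [s - of_nat n - of_nat (Suc (Suc c))])
                          (of_nat n + of_nat (Suc (Suc c)))) -
     (\<Sum>n. G_q q (Suc c) (ss @ [- of_nat n]) (s + of_nat n))"

end

theory Submission
  imports Defs
begin

text \<open>Put \<open>x\<^sub>n = q\<^sup>n / [n]\<^sub>q\<close>, so that the summand of \<open>\<zeta>\<^sub>q\<close> is \<open>q\<^bsup>-n\<^esup> x\<^sub>n\<^sup>s\<close>, and let \<open>h\<^sub>k(i, j)\<close> be the complete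
  homogeneous symmetric polynomial of degree \<open>k\<close> in \<open>x\<^sub>i, \<dots>, x\<^sub>j\<close>. By induction on \<open>b\<close>,
  \<open>G\<^sub>q\<^bsup>(a,b)\<^esup>(s\<^sub>1, \<dots>, s\<^sub>a; s)\<close> is the sum over \<open>0 < n\<^sub>1 < \<dots> < n\<^sub>a < m\<close> of the summands for \<open>s\<^sub>1, \<dots>, s\<^sub>a\<close> times
  \<open>q\<^bsup>-m\<^esup> x\<^sub>m\<^bsup>s-b+1\<^esup> h\<^bsub>b-1\<^esub>(m - n\<^sub>a, m)\<close>. In the induction step the series over \<open>n\<close> are geometric in
  \<open>x\<^sub>M / x\<^sub>m\<close>, where \<open>M > m\<close> are the two largest indices, and sum up to the factors \<open>x\<^bsub>M-m\<^esub> - x\<^sub>M\<close> and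
  \<open>x\<^bsub>M-m\<^esub>\<close>. These telescope against \<open>h\<^bsub>b-2\<^esub>(M - m, M)\<close>: the first
  double series becomes a sum over \<open>m\<close> with coefficient \<open>h\<^bsub>b-1\<^esub>(1, m)\<close>, the second a sum over \<open>M\<close> with coefficient
  \<open>h\<^bsub>b-1\<^esub>(1, M) - h\<^bsub>b-1\<^esub>(M - n\<^sub>a, M)\<close>. For \<open>a = 0\<close> the remaining factor \<open>h\<^bsub>b-1\<^esub>(m, m)\<close> is \<open>x\<^sub>m\<^bsup>b-1\<^esup>\<close>.\<close>

section \<open>Weighted infinite sums\<close>

text \<open>As the kernel is nonnegative, the norms over a fibre add up to
  \<open>norm (f x) * g x\<close>, which is the norm of the collapsed term. Absolute summability
  over pairs thus reduces to the outer index.\<close>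

lemma weighted_Sigma_abs_summable:
  fixes f :: "'a \<Rightarrow> complex" and k :: "'a \<Rightarrow> 'b \<Rightarrow> real"
  assumes k: "\<And>x. x \<in> A \<Longrightarrow> (k x has_sum g x) (B x)"
    and nonneg: "\<And>x y. x \<in> A \<Longrightarrow> y \<in> B x \<Longrightarrow> k x y \<ge> 0"
    and summable: "(\<lambda>x. norm (f x * of_real (g x))) summable_on A"
  shows "(\<lambda>(x, y). norm (f x * of_real (k x y))) summable_on Sigma A B"
proof (rule summable_on_SigmaI)
  have g: "g x \<ge> 0" if "x \<in> A" for x
    using has_sum_nonneg[OF k[OF that]] nonneg that by blast
  show "((\<lambda>y. case (x, y) of (x, y) \<Rightarrow> norm (f x * of_real (k x y))) has_sum norm (f x * of_real (g x))) (B x)"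
    if "x \<in> A" for x
  proof -
    have "((\<lambda>y. norm (f x) * k x y) has_sum norm (f x) * g x) (B x)"
      by (intro has_sum_cmult_right k that)
    moreover have "norm (f x * of_real (k x y)) = norm (f x) * k x y" if "y \<in> B x" for y
      using nonneg[OF \<open>x \<in> A\<close> that] by (simp add: norm_mult)
    ultimately have "((\<lambda>y. norm (f x * of_real (k x y))) has_sum norm (f x) * g x) (B x)"
      by (simp cong: has_sum_cong)
    then show ?thesis
      using g[OF that] by (simp add: norm_mult)
  qed
qed (use summable in auto)

lemma weighted_Sigma_has_sum:
  fixes f :: "'a \<Rightarrow> complex" and k :: "'a \<Rightarrow> 'b \<Rightarrow> real"
  assumes k: "\<And>x. x \<in> A \<Longrightarrow> (k x has_sum g x) (B x)"
    and nonneg: "\<And>x y. x \<in> A \<Longrightarrow> y \<in> B x \<Longrightarrow> k x y \<ge> 0"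
    and summable: "(\<lambda>x. norm (f x * of_real (g x))) summable_on A"
  shows "((\<lambda>(x, y). f x * of_real (k x y)) has_sum (\<Sum>\<^sub>\<infinity>x\<in>A. f x * of_real (g x))) (Sigma A B)"
proof (rule has_sum_SigmaI)
  show "((\<lambda>y. case (x, y) of (x, y) \<Rightarrow> f x * of_real (k x y)) has_sum f x * of_real (g x)) (B x)"
    if "x \<in> A" for x
    using that by (auto intro!: has_sum_cmult_right has_sum_of_real k)
  show "((\<lambda>x. f x * of_real (g x)) has_sum (\<Sum>\<^sub>\<infinity>x\<in>A. f x * of_real (g x))) A"
    using abs_summable_summable[OF summable] by (rule has_sum_infsum)
  show "(\<lambda>(x, y). f x * of_real (k x y)) summable_on Sigma A B"
  proof (rule abs_summable_summable)
    have "(\<lambda>(x, y). norm (f x * of_real (k x y))) summable_on Sigma A B"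
      by (rule weighted_Sigma_abs_summable) (use assms in auto)
    then show "(\<lambda>z. norm (case z of (x, y) \<Rightarrow> f x * of_real (k x y))) summable_on Sigma A B"
      by (simp add: case_prod_unfold)
  qed
qed

text \<open>A series of nonnegative terms is also an unordered sum, so Fubini on
  \<open>A \<times> UNIV\<close> applies. Absolute summability with the total weight
  \<open>g\<close> is enough to move the series over \<open>n\<close> outside.\<close>

lemma weighted_infsum_sums:
  fixes f :: "'a \<Rightarrow> complex" and k :: "'a \<Rightarrow> nat \<Rightarrow> real"
  assumes k: "\<And>x. x \<in> A \<Longrightarrow> k x sums g x"
    and nonneg: "\<And>x n. x \<in> A \<Longrightarrow> k x n \<ge> 0"
    and summable: "(\<lambda>x. norm (f x * of_real (g x))) summable_on A"
  shows "(\<lambda>n. \<Sum>\<^sub>\<infinity>x\<in>A. f x * of_real (k x n)) sums (\<Sum>\<^sub>\<infinity>x\<in>A. f x * of_real (g x))"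
proof -
  have "((\<lambda>(x, n). f x * of_real (k x n)) has_sum (\<Sum>\<^sub>\<infinity>x\<in>A. f x * of_real (g x))) (A \<times> UNIV)"
    using assms by (intro weighted_Sigma_has_sum sums_nonneg_imp_has_sum) auto
  \<comment> \<open>After swapping, \<open>n\<close> is the outer index, so the partial sums over
    \<open>x\<close> become the terms of the series.\<close>
  then have sum: "((\<lambda>(n, x). f x * of_real (k x n)) has_sum (\<Sum>\<^sub>\<infinity>x\<in>A. f x * of_real (g x))) (UNIV \<times> A)"
    by (subst (asm) has_sum_swap) simp
  show ?thesis
  proof (rule has_sum_imp_sums, rule has_sum_SigmaD[OF sum])
    fix n :: nat
    have "(\<lambda>x. f x * of_real (k x n)) summable_on A"
      using sum by (intro summable_on_SigmaD1[where A = UNIV and B = "\<lambda>_. A"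
            and f = "\<lambda>n x. f x * of_real (k x n)"]) (auto simp: summable_on_def)
    then show "((\<lambda>x. case (n, x) of (n, x) \<Rightarrow> f x * of_real (k x n)) has_sum
        (\<Sum>\<^sub>\<infinity>x\<in>A. f x * of_real (k x n))) A"
      by simp
  qed
qed

lemma norm_summable_on_mult_bounded:
  fixes f :: "'a \<Rightarrow> complex"
  assumes "(\<lambda>x. norm (f x)) summable_on A" and "\<And>x. x \<in> A \<Longrightarrow> \<bar>g x\<bar> \<le> C"
  shows "(\<lambda>x. norm (f x * of_real (g x))) summable_on A"
proof (rule summable_on_comparison_test)
  show "(\<lambda>x. norm (f x) * C) summable_on A"
    using assms(1) by (rule summable_on_cmult_left)
  show "norm (f x * of_real (g x)) \<le> norm (f x) * C" if "x \<in> A" for x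
    using assms(2)[OF that] by (simp add: norm_mult mult_left_mono)
qed simp

section \<open>Complete homogeneous symmetric polynomials\<close>

text \<open>The recursion splits monomials by their smallest index \<open>l\<close>. An empty range
  gives 1 in degree 0 and 0 in positive degree.\<close>

fun hom_sym :: "(nat \<Rightarrow> 'a :: comm_ring_1) \<Rightarrow> nat \<Rightarrow> nat \<Rightarrow> nat \<Rightarrow> 'a" where
  "hom_sym x 0 i j = 1"
| "hom_sym x (Suc k) i j = (\<Sum>l=i..j. x l * hom_sym x k l j)"

lemma hom_sym_lower:
  assumes "i \<le> j"
  shows "hom_sym x (Suc k) i j = x i * hom_sym x k i j + hom_sym x (Suc k) (Suc i) j"
  using assms by (simp add: sum.atLeast_Suc_atMost)

text \<open>Monomials are split by whether they contain the largest variable. The definition peels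
  off the smallest one, hence the induction on the degree.\<close>

lemma hom_sym_upper:
  assumes "i \<le> Suc j"
  shows "hom_sym x (Suc k) i (Suc j) = hom_sym x (Suc k) i j + x (Suc j) * hom_sym x k i (Suc j)"
  using assms
proof (induction k arbitrary: i)
  case 0
  then show ?case by (simp add: algebra_simps)
next
  case (Suc k)
  have "hom_sym x (Suc (Suc k)) i (Suc j) = (\<Sum>l=i..Suc j. x l * hom_sym x (Suc k) l (Suc j))"
    by simp
  also have "\<dots> = (\<Sum>l=i..Suc j. x l * (hom_sym x (Suc k) l j + x (Suc j) * hom_sym x k l (Suc j)))"
    using Suc.IH by (intro sum.cong) auto
  also have "\<dots> = (\<Sum>l=i..Suc j. x l * hom_sym x (Suc k) l j) + x (Suc j) * hom_sym x (Suc k) i (Suc j)"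
    by (simp add: algebra_simps sum.distrib sum_distrib_left del: sum.cl_ivl_Suc)
  \<comment> \<open>The extra term \<open>l = Suc j\<close> vanishes, being of positive degree over
    an empty range.\<close>
  also have "(\<Sum>l=i..Suc j. x l * hom_sym x (Suc k) l j) = hom_sym x (Suc (Suc k)) i j"
    using Suc.prems by simp
  finally show ?case .
qed

text \<open>Expanding \<open>hom_sym x (Suc k) i (Suc j)\<close> at either end and equating the
  results gives the difference that makes the sums over \<open>M\<close> telescope.\<close>

lemma hom_sym_diff:
  assumes "i \<le> Suc j"
  shows "(x i - x (Suc j)) * hom_sym x k i (Suc j) =
    hom_sym x (Suc k) i j - hom_sym x (Suc k) (Suc i) (Suc j)"
  using hom_sym_upper[OF assms, of x k] hom_sym_lower[OF assms, of x k]
  by (simp add: algebra_simps del: hom_sym.simps)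

lemma hom_sym_singleton: "hom_sym x k i i = x i ^ k"
  by (induction k) auto

lemma hom_sym_nonneg:
  fixes x :: "nat \<Rightarrow> real"
  assumes "\<And>l. x l \<ge> 0"
  shows "hom_sym x k i j \<ge> 0"
  by (induction k arbitrary: i) (auto intro!: sum_nonneg mult_nonneg_nonneg assms)

text \<open>The first bound is uniform in the range. The second keeps one factor as a partial sum,
  which becomes small when the range moves to infinity.\<close>

lemma hom_sym_le:
  fixes x :: "nat \<Rightarrow> real"
  assumes x: "\<And>l. x l \<ge> 0" and X: "\<And>i j. (\<Sum>l=i..j. x l) \<le> X"
  shows "hom_sym x k i j \<le> X ^ k"
    and "hom_sym x (Suc k) i j \<le> (\<Sum>l=i..j. x l) * X ^ k"
proof -
  have X0: "X \<ge> 0"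
    using X[of 1 0] by simp
  have step: "hom_sym x (Suc k) i j \<le> (\<Sum>l=i..j. x l) * X ^ k"
    if "\<And>i. hom_sym x k i j \<le> X ^ k" for i k
    using that by (auto simp: sum_distrib_right intro!: sum_mono mult_left_mono x)
  show bound: "hom_sym x k i j \<le> X ^ k" for i k
  proof (induction k arbitrary: i)
    case (Suc k)
    have "hom_sym x (Suc k) i j \<le> (\<Sum>l=i..j. x l) * X ^ k"
      by (intro step Suc)
    also have "\<dots> \<le> X * X ^ k"
      using X0 by (intro mult_right_mono X) auto
    finally show ?case by simp
  qed simp
  show "hom_sym x (Suc k) i j \<le> (\<Sum>l=i..j. x l) * X ^ k"
    by (intro step bound)
qed

section \<open>The summands of the \<open>q\<close>-multiple zeta function\<close>

definition q_base :: "real \<Rightarrow> nat \<Rightarrow> real" where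
  "q_base q n = q ^ n / q_int q n"

definition q_term :: "real \<Rightarrow> nat \<Rightarrow> complex \<Rightarrow> complex" where
  "q_term q n s = complex_of_real q powr ((s - 1) * of_nat n) / complex_of_real (q_int q n) powr s"

definition q_prod :: "real \<Rightarrow> complex list \<Rightarrow> nat list \<Rightarrow> complex" where
  "q_prod q ss ns = (\<Prod>j<length ss. q_term q (ns ! j) (ss ! j))"

text \<open>The lower bound \<open>N\<close> is a parameter so that the tail after a first entry
  \<open>n\<close> is again of this kind, with bound \<open>n\<close>.\<close>

definition increasing_lists :: "nat \<Rightarrow> nat \<Rightarrow> nat list set" where
  "increasing_lists N r = {ns. length ns = r \<and> sorted_wrt (<) (N # ns)}"

lemma zeta_q_eq: "zeta_q q ss = (\<Sum>\<^sub>\<infinity>ns\<in>increasing_lists 0 (length ss). q_prod q ss ns)"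
  unfolding zeta_q_def increasing_lists_def q_prod_def q_term_def ..

lemma increasing_lists_0: "increasing_lists N 0 = {[]}"
  by (auto simp: increasing_lists_def)

lemma bij_betw_increasing_lists_Cons:
  "bij_betw (\<lambda>(n, ns). n # ns) (SIGMA n:{N<..}. increasing_lists n r) (increasing_lists N (Suc r))"
proof (rule bij_betwI[where g = "\<lambda>ns. (hd ns, tl ns)"])
  show "(\<lambda>(n, ns). n # ns) \<in> (SIGMA n:{N<..}. increasing_lists n r) \<rightarrow> increasing_lists N (Suc r)"
    by (force simp: increasing_lists_def)
  show "(\<lambda>ns. (hd ns, tl ns)) \<in> increasing_lists N (Suc r) \<rightarrow> (SIGMA n:{N<..}. increasing_lists n r)"
    by (auto simp: increasing_lists_def length_Suc_conv)
qed (auto simp: increasing_lists_def length_Suc_conv)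

lemma sorted_wrt_less_snoc:
  "sorted_wrt (<) ((N :: nat) # ns @ [m]) \<longleftrightarrow> sorted_wrt (<) (N # ns) \<and> last (N # ns) < m"
proof -
  have "sorted_wrt (<) (xs @ [m]) \<longleftrightarrow> sorted_wrt (<) xs \<and> last xs < m" if "xs \<noteq> []" for xs :: "nat list"
    using that by (induction xs rule: rev_induct) (auto simp: sorted_wrt_append)
  from this[of "N # ns"] show ?thesis by simp
qed

text \<open>Splitting off the largest index serves the recursion for \<open>G_q\<close>; splitting
  off the smallest one serves the convergence proof.\<close>

lemma bij_betw_increasing_lists_snoc:
  "bij_betw (\<lambda>(ns, m). ns @ [m]) (SIGMA ns:increasing_lists N r. {last (N # ns)<..}) (increasing_lists N (Suc r))"
proof (rule bij_betwI[where g = "\<lambda>ns. (butlast ns, last ns)"])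
  show "(\<lambda>(ns, m). ns @ [m]) \<in> (SIGMA ns:increasing_lists N r. {last (N # ns)<..}) \<rightarrow> increasing_lists N (Suc r)"
    using sorted_wrt_less_snoc by (auto simp: increasing_lists_def simp del: sorted_wrt.simps last.simps)
  show "(\<lambda>ns. (butlast ns, last ns)) \<in> increasing_lists N (Suc r) \<rightarrow> (SIGMA ns:increasing_lists N r. {last (N # ns)<..})"
  proof
    fix ns assume ns: "ns \<in> increasing_lists N (Suc r)"
    then obtain ms m where "ns = ms @ [m]"
      by (metis (mono_tags, lifting) increasing_lists_def mem_Collect_eq length_0_conv nat.distinct(1) rev_exhaust)
    with ns sorted_wrt_less_snoc[of N ms m] show "(butlast ns, last ns) \<in> (SIGMA ns:increasing_lists N r. {last (N # ns)<..})"
      by (auto simp: increasing_lists_def simp del: sorted_wrt.simps last.simps)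
  qed
next
  fix ns assume "ns \<in> increasing_lists N (Suc r)"
  then have "ns \<noteq> []"
    by (auto simp: increasing_lists_def)
  then show "(\<lambda>(ns, m). ns @ [m]) (butlast ns, last ns) = ns"
    by simp
qed auto

lemma q_prod_snoc:
  assumes "length ns = length ss"
  shows "q_prod q (ss @ [s]) (ns @ [m]) = q_prod q ss ns * q_term q m s"
proof -
  have "(\<Prod>j<length ss. q_term q ((ns @ [m]) ! j) ((ss @ [s]) ! j)) = q_prod q ss ns"
    using assms unfolding q_prod_def by (intro prod.cong) (auto simp: nth_append)
  then show ?thesis
    using assms by (simp add: q_prod_def nth_append)
qed

section \<open>Elementary estimates for \<open>q_int\<close> and \<open>q_base\<close>\<close>

context
  fixes q :: real
  assumes q: "0 < q" "q < 1"
begin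

lemma q_int_ge_1:
  assumes "n \<ge> 1"
  shows "q_int q n \<ge> 1"
proof -
  have "q ^ n \<le> q ^ 1"
    using q assms by (intro power_decreasing) auto
  then show ?thesis
    using q by (simp add: q_int_def field_simps)
qed

lemma q_int_le: "q_int q n \<le> 1 / (1 - q)"
  using q by (simp add: q_int_def divide_right_mono)

lemma q_base_pos: "n \<ge> 1 \<Longrightarrow> q_base q n > 0"
  using q q_int_ge_1[of n] by (simp add: q_base_def)

text \<open>Division by zero yields 0 here, so \<open>q_base\<close> is nonnegative at every
  index.\<close>

lemma q_base_0: "q_base q 0 = 0"
  by (simp add: q_base_def q_int_def)

lemma q_base_nonneg: "q_base q n \<ge> 0"
  using q_base_pos[of n] q_base_0 by (cases n) auto

lemma q_base_le: "q_base q n \<le> q ^ n"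
  using q q_int_ge_1[of n] q_base_0 by (cases n) (auto simp: q_base_def field_simps)

lemma q_base_eq: "q_base q n = (1 - q) * q ^ n / (1 - q ^ n)"
  by (simp add: q_base_def q_int_def)

lemma sum_q_base_le: "(\<Sum>l=i..j. q_base q l) \<le> q ^ i / (1 - q)"
proof -
  have "(\<Sum>l=i..j. q_base q l) \<le> (\<Sum>l=i..j. q ^ l)"
    by (intro sum_mono q_base_le)
  also have "\<dots> \<le> q ^ i / (1 - q)"
    using q by (auto simp: sum_gp divide_right_mono)
  finally show ?thesis .
qed

lemma sum_q_base_le': "(\<Sum>l=i..j. q_base q l) \<le> 1 / (1 - q)"
  using sum_q_base_le[of i j] q power_le_one[of q i]
  by (meson diff_gt_0_iff_gt divide_right_mono less_imp_le order_trans)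

section \<open>Bounds and telescoping sums for complete homogeneous polynomials in
  \<open>q_base\<close>\<close>

private abbreviation (input) h :: "nat \<Rightarrow> nat \<Rightarrow> nat \<Rightarrow> real" where
  "h \<equiv> hom_sym (q_base q)"

lemma h_nonneg: "h k i j \<ge> 0"
  by (intro hom_sym_nonneg q_base_nonneg)

lemma h_le: "h k i j \<le> (1 / (1 - q)) ^ k"
  by (intro hom_sym_le q_base_nonneg sum_q_base_le')

text \<open>The window of \<open>m\<close> variables moves to infinity, and its sum is at most
  \<open>q ^ Suc n / (1 - q)\<close>. This is the limit term of the telescoping series.\<close>

lemma h_tendsto_0: "(\<lambda>n. h (Suc k) (Suc n) (n + m)) \<longlonglongrightarrow> 0"
proof (rule tendsto_sandwich[where f = "\<lambda>_. 0" and h = "\<lambda>n. q ^ Suc n / (1 - q) * (1 / (1 - q)) ^ k"])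
  show "\<forall>\<^sub>F n in sequentially. h (Suc k) (Suc n) (n + m) \<le> q ^ Suc n / (1 - q) * (1 / (1 - q)) ^ k"
  proof (rule always_eventually, rule allI)
    fix n
    have "h (Suc k) (Suc n) (n + m) \<le> (\<Sum>l=Suc n..n + m. q_base q l) * (1 / (1 - q)) ^ k"
      by (intro hom_sym_le q_base_nonneg sum_q_base_le')
    also have "\<dots> \<le> q ^ Suc n / (1 - q) * (1 / (1 - q)) ^ k"
      using q by (intro mult_right_mono sum_q_base_le) auto
    finally show "h (Suc k) (Suc n) (n + m) \<le> q ^ Suc n / (1 - q) * (1 / (1 - q)) ^ k" .
  qed
  have "(\<lambda>n. q ^ n) \<longlonglongrightarrow> 0"
    using q by (intro LIMSEQ_realpow_zero) auto
  then have "(\<lambda>n. q * q ^ n / (1 - q) * (1 / (1 - q)) ^ k) \<longlonglongrightarrow> q * 0 / (1 - q) * (1 / (1 - q)) ^ k"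
    using q by (intro tendsto_intros) auto
  then show "(\<lambda>n. q ^ Suc n / (1 - q) * (1 / (1 - q)) ^ k) \<longlonglongrightarrow> 0"
    by simp
qed (simp_all add: h_nonneg del: hom_sym.simps)

text \<open>Numerator \<open>q ^ n\<close> decreases and denominator \<open>q_int q n\<close>
  increases. Index 0 must be excluded, since the value there is 0.\<close>

lemma q_base_antimono:
  assumes "1 \<le> m" "m \<le> n"
  shows "q_base q n \<le> q_base q m"
proof -
  have "q ^ n \<le> q ^ m"
    using q assms by (intro power_decreasing) auto
  moreover have "q_int q m \<le> q_int q n"
    using q \<open>q ^ n \<le> q ^ m\<close> by (simp add: q_int_def divide_right_mono)
  ultimately show ?thesis
    unfolding q_base_def using q q_int_ge_1[of m] assms by (intro frac_le) auto
qed

text \<open>With \<open>M = Suc n + m\<close>, \<open>hom_sym_diff\<close> turns each term into a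
  difference of consecutive windows, of which only the first, \<open>h (Suc k) 1 m\<close>,
  survives.\<close>

lemma has_sum_h_tail:
  "((\<lambda>M. (q_base q (M - m) - q_base q M) * h k (M - m) M) has_sum h (Suc k) 1 m) {m<..}"
proof -
  have "(\<lambda>n. h (Suc k) (Suc n) (n + m) - h (Suc k) (Suc (Suc n)) (Suc n + m)) sums
      (h (Suc k) (Suc 0) (0 + m) - 0)"
    by (rule telescope_sums'[OF h_tendsto_0])
  moreover have "h (Suc k) (Suc n) (n + m) - h (Suc k) (Suc (Suc n)) (Suc n + m) =
      (q_base q (Suc n) - q_base q (Suc n + m)) * h k (Suc n) (Suc n + m)" for n
    using hom_sym_diff[of "Suc n" "n + m" "q_base q" k] by simp
  ultimately have sums: "(\<lambda>n. (q_base q (Suc n) - q_base q (Suc n + m)) * h k (Suc n) (Suc n + m)) sums h (Suc k) 1 m"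
    by (simp del: hom_sym.simps)
  have "((\<lambda>n. (q_base q (Suc n) - q_base q (Suc n + m)) * h k (Suc n) (Suc n + m)) has_sum h (Suc k) 1 m) UNIV"
    by (rule sums_nonneg_imp_has_sum[OF sums]) (intro mult_nonneg_nonneg h_nonneg, auto intro: q_base_antimono)
  also have "?this \<longleftrightarrow> ?thesis"
    by (rule has_sum_reindex_bij_witness[where i = "\<lambda>M. M - Suc m" and j = "\<lambda>n. Suc n + m"]) auto
  finally show ?thesis .
qed

text \<open>With \<open>i = M - m\<close>, \<open>hom_sym_lower\<close> turns each term into a
  difference in the lower end \<open>i\<close>, which runs from 1 to
  \<open>M - N - 1\<close>.\<close>

lemma sum_h_initial:
  assumes "N < M"
  shows "(\<Sum>m\<in>{N<..<M}. q_base q (M - m) * h k (M - m) M) = h (Suc k) 1 M - h (Suc k) (M - N) M"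
proof -
  have "(\<Sum>m\<in>{N<..<M}. q_base q (M - m) * h k (M - m) M) = (\<Sum>i\<in>{1..<M - N}. q_base q i * h k i M)"
    by (rule sum.reindex_bij_witness[where i = "\<lambda>i. M - i" and j = "\<lambda>m. M - m"]) auto
  also have "\<dots> = (\<Sum>i\<in>{1..<M - N}. h (Suc k) i M - h (Suc k) (Suc i) M)"
    using assms by (intro sum.cong refl) (subst hom_sym_lower, auto simp del: hom_sym.simps)
  also have "\<dots> = h (Suc k) 1 M - h (Suc k) (M - N) M"
    using assms sum_Suc_diff'[of 1 "M - N" "\<lambda>i. - h (Suc k) i M"] by (simp del: hom_sym.simps)
  finally show ?thesis .
qed

text \<open>The last two quotients are sums of geometric series with ratio
  \<open>q_base q n / q_base q m\<close>, as they arise from the two series in the recursion. The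
  powers of \<open>q\<close> on the right cancel against \<open>q_term q m 0\<close> and
  \<open>q_term q n 0\<close>.\<close>

lemma q_base_ratio:
  assumes "1 \<le> m" "m < n"
  shows "q_base q n / q_base q m < 1"
    and "q_base q n / (1 - q_base q n / q_base q m) = q ^ m * q_base q (n - m)"
    and "q_base q n / q_base q m * q_base q n / (1 - q_base q n / q_base q m) =
      q ^ n * (q_base q (n - m) - q_base q n)"
proof -
  obtain d where n: "n = m + d" and d: "d \<ge> 1"
    using assms by (metis less_imp_add_positive One_nat_def Suc_leI)
  have lt1: "q ^ k < 1" if "k \<ge> 1" for k
    using q that by (simp add: power_less_one_iff)
  define u where "u = q ^ m"
  define v where "v = q ^ d"
  have u: "0 < u" "u < 1" and v: "0 < v" "v < 1"
    using q assms d lt1 by (auto simp: u_def v_def)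
  have uv: "u * v < 1"
    using u v mult_strict_mono[of u 1 v 1] by simp
  have xn: "q_base q n = (1 - q) * (u * v) / (1 - u * v)" and xm: "q_base q m = (1 - q) * u / (1 - u)"
    and xd: "q_base q (n - m) = (1 - q) * v / (1 - v)"
    by (simp_all add: q_base_eq n u_def v_def power_add)
  have ratio: "q_base q n / q_base q m = v * (1 - u) / (1 - u * v)"
    using u q by (simp add: xn xm)
  have "1 - v * (1 - u) / (1 - u * v) = (1 - v) / (1 - u * v)"
    using uv by (simp add: field_simps)
  then have compl: "1 - q_base q n / q_base q m = (1 - v) / (1 - u * v)"
    by (simp add: ratio)
  then show "q_base q n / q_base q m < 1"
    using v uv by (metis diff_gt_0_iff_gt divide_pos_pos)
  show "q_base q n / (1 - q_base q n / q_base q m) = q ^ m * q_base q (n - m)"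
    unfolding compl unfolding xn xd u_def[symmetric] using uv by simp
  have "q_base q n / q_base q m * q_base q n / (1 - q_base q n / q_base q m) =
      (v * (1 - u) / (1 - u * v)) * ((1 - q) * (u * v) / (1 - u * v)) / ((1 - v) / (1 - u * v))"
    unfolding compl unfolding ratio unfolding xn ..
  also have "\<dots> = (u * v) * ((1 - q) * v / (1 - v) - (1 - q) * (u * v) / (1 - u * v))"
  proof -
    \<comment> \<open>Abstracting the two denominators leaves a polynomial identity between
      numerators.\<close>
    define w where "w = 1 - u * v"
    define z where "z = 1 - v"
    have "w \<noteq> 0" "z \<noteq> 0" using v uv by (auto simp: w_def z_def)
    from diff_frac_eq[OF this(2,1)] have "(1 - q) * v / z - (1 - q) * (u * v) / w = ((1 - q) * v * w - (1 - q) * (u * v) * z) / (z * w)"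
      by simp
    also have "(1 - q) * v * w - (1 - q) * (u * v) * z = (1 - q) * (v * (1 - u))"
      unfolding w_def z_def by algebra
    finally show ?thesis
      unfolding w_def[symmetric] z_def[symmetric] using \<open>w \<noteq> 0\<close> by (simp add: mult_ac)
  qed
  also have "\<dots> = q ^ n * (q_base q (n - m) - q_base q n)"
    unfolding xd xn by (simp add: n u_def v_def power_add)
  finally show "q_base q n / q_base q m * q_base q n / (1 - q_base q n / q_base q m) =
      q ^ n * (q_base q (n - m) - q_base q n)" .
qed

text \<open>Raising \<open>s\<close> by one multiplies the numerator by \<open>q ^ n\<close> and the
  denominator by \<open>q_int q n\<close>, hence the summand by \<open>q_base q n\<close>.\<close>

lemma q_term_add_nat:
  assumes "n \<ge> 1"
  shows "q_term q n (s + of_nat k) = q_term q n s * of_real (q_base q n ^ k)"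
proof -
  have 1: "complex_of_real (q_int q n) powr (s + of_nat k) =
      complex_of_real (q_int q n) powr s * of_real (q_int q n ^ k)"
    using q_int_ge_1[OF assms] by (simp add: powr_add powr_nat)
  have "(s + of_nat k - 1) * of_nat n = (s - 1) * of_nat n + of_nat (n * k)"
    by (simp add: algebra_simps)
  then have 2: "complex_of_real q powr ((s + of_nat k - 1) * of_nat n) =
      complex_of_real q powr ((s - 1) * of_nat n) * of_real ((q ^ n) ^ k)"
    using q by (simp only: powr_add) (simp add: powr_nat power_mult del: of_nat_mult)
  show ?thesis
    unfolding q_term_def 1 2 by (simp add: q_base_def power_divide)
qed

lemma q_term_diff_nat:
  assumes "n \<ge> 1"
  shows "q_term q n (s - of_nat k) = q_term q n s / of_real (q_base q n ^ k)"
  using q_term_add_nat[OF assms, of "s - of_nat k" k] q_base_pos[OF assms] by (simp add: field_simps)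

lemma q_term_0:
  assumes "n \<ge> 1"
  shows "q_term q n 0 = 1 / of_real (q ^ n)"
proof -
  \<comment> \<open>Needed because \<open>0 powr 0 = 0\<close>.\<close>
  have "q_int q n \<noteq> 0"
    using q_int_ge_1[OF assms] by simp
  then show ?thesis
    using q by (simp add: q_term_def powr_minus powr_nat field_simps)
qed

text \<open>Since \<open>q_int q n\<close> lies between 1 and \<open>1 / (1 - q)\<close>, its powers
  are bounded uniformly in \<open>n\<close>, and the summand decays like a geometric
  sequence.\<close>

lemma norm_q_term_le:
  assumes "n \<ge> 1"
  shows "norm (q_term q n s) \<le> (1 / (1 - q)) powr \<bar>Re s\<bar> * (q powr (Re s - 1)) ^ n"
proof -
  have i: "q_int q n \<ge> 1"
    by (rule q_int_ge_1[OF assms])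
  have "norm (q_term q n s) = q powr ((Re s - 1) * real n) / q_int q n powr Re s"
    using q i by (simp add: q_term_def norm_divide norm_powr_real_powr)
  also have "q powr ((Re s - 1) * real n) = (q powr (Re s - 1)) ^ n"
    using q by (simp add: powr_powr[symmetric] powr_realpow)
  also have "(q powr (Re s - 1)) ^ n / q_int q n powr Re s = q_int q n powr (- Re s) * (q powr (Re s - 1)) ^ n"
    by (simp add: powr_minus field_simps)
  also have "q_int q n powr (- Re s) \<le> q_int q n powr \<bar>Re s\<bar>"
    using i by (intro powr_mono) auto
  also have "q_int q n powr \<bar>Re s\<bar> \<le> (1 / (1 - q)) powr \<bar>Re s\<bar>"
    using i by (intro powr_mono2 q_int_le) auto
  finally show ?thesis
    by (simp add: mult_right_mono)
qed

section \<open>Absolute convergence\<close>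

lemma has_sum_geometric_greaterThan:
  fixes c :: real
  assumes "0 < c" "c < 1"
  shows "((\<lambda>n. c ^ n) has_sum (c / (1 - c) * c ^ N)) {N<..}"
proof -
  have "(\<lambda>n. c ^ Suc N * c ^ n) sums (c ^ Suc N * (1 / (1 - c)))"
    using assms by (intro sums_mult geometric_sums) auto
  then have "((\<lambda>n. c ^ (Suc n + N)) has_sum (c / (1 - c) * c ^ N)) UNIV"
    using assms by (intro sums_nonneg_imp_has_sum) (auto simp: power_add mult_ac)
  also have "?this \<longleftrightarrow> ?thesis"
    by (rule has_sum_reindex_bij_witness[where i = "\<lambda>M. M - Suc N" and j = "\<lambda>n. Suc n + N"]) auto
  finally show ?thesis .
qed

text \<open>Summing over the smallest index last keeps the sum geometric in the lower bound \<open>N\<close>.\<close>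

lemma has_sum_increasing_lists:
  assumes "\<And>us vs. ts = us @ vs \<Longrightarrow> vs \<noteq> [] \<Longrightarrow> sum_list vs > 0"
  shows "\<exists>C. \<forall>N. ((\<lambda>ns. \<Prod>j<length ts. (q powr (ts ! j)) ^ (ns ! j)) has_sum
    (C * (q powr sum_list ts) ^ N)) (increasing_lists N (length ts))"
  using assms
proof (induction ts)
  case Nil
  show ?case
    using q by (intro exI[of _ 1]) (simp add: increasing_lists_0 has_sum_finiteI)
next
  case (Cons t ts)
  define P where "P = (\<lambda>ns. \<Prod>j<length ts. (q powr (ts ! j)) ^ (ns ! j))"
  have "sum_list vs > 0" if "ts = us @ vs" "vs \<noteq> []" for us vs
    using Cons.prems[of "t # us" vs] that by auto
  then obtain C where "\<forall>N. (P has_sum (C * (q powr sum_list ts) ^ N)) (increasing_lists N (length ts))"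
    using Cons.IH unfolding P_def by blast
  then have C: "(P has_sum (C * (q powr sum_list ts) ^ N)) (increasing_lists N (length ts))" for N ..
  have P: "P ns \<ge> 0" for ns
    unfolding P_def by (intro prod_nonneg) auto
  \<comment> \<open>Summing over the tail above \<open>n\<close> contributes
    \<open>q powr sum_list ts\<close> to the power \<open>n\<close>, so the sum over
    \<open>n\<close> is geometric with ratio \<open>c\<close>. The hypothesis for the whole list
    gives \<open>c < 1\<close>.\<close>
  define c where "c = q powr (t + sum_list ts)"
  have c: "0 < c" "c < 1"
    using q Cons.prems[of "[]" "t # ts"] by (auto simp: c_def powr01_less_one)
  have inner: "((\<lambda>ns. (q powr t) ^ n * P ns) has_sum C * c ^ n) (increasing_lists n (length ts))" for n
    using has_sum_cmult_right[OF C[of n], of "(q powr t) ^ n"]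
    by (simp add: c_def powr_add power_mult_distrib mult_ac)
  have outer: "((\<lambda>n. C * c ^ n) has_sum C * (c / (1 - c) * c ^ N)) {N<..}" for N
    by (intro has_sum_cmult_right has_sum_geometric_greaterThan c)
  have sum: "((\<lambda>(n, ns). (q powr t) ^ n * P ns) has_sum C * (c / (1 - c) * c ^ N))
      (SIGMA n:{N<..}. increasing_lists n (length ts))" for N
  proof (rule has_sum_SigmaI[OF _ outer])
    show "(\<lambda>(n, ns). (q powr t) ^ n * P ns) summable_on (SIGMA n:{N<..}. increasing_lists n (length ts))"
    proof (rule summable_on_SigmaI)
      show "(\<lambda>n. C * c ^ n) summable_on {N<..}"
        using outer by (rule has_sum_imp_summable)
    qed (simp_all add: inner P)
  qed (simp add: inner)
  have prod_Cons: "(\<Prod>j<length (t # ts). (q powr ((t # ts) ! j)) ^ ((n # ns) ! j)) = (q powr t) ^ n * P ns" for n ns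
    by (simp only: list.size add_Suc_right add_0_right prod.lessThan_Suc_shift) (simp add: P_def)
  have "((\<lambda>ns. \<Prod>j<length (t # ts). (q powr ((t # ts) ! j)) ^ (ns ! j)) has_sum
      (C * (c / (1 - c)) * c ^ N)) (increasing_lists N (Suc (length ts)))" for N
    using sum[of N]
    by (subst has_sum_reindex_bij_betw[OF bij_betw_increasing_lists_Cons, symmetric])
      (simp only: case_prod_unfold prod_Cons mult.assoc)
  then show ?case
    by (intro exI[of _ "C * (c / (1 - c))"]) (simp add: c_def)
qed

text \<open>Up to a constant, each factor is bounded by a power with exponent
  \<open>Re s - 1\<close>. Subtracting 1 from every entry turns the region of convergence into
  positivity of all suffix sums.\<close>

lemma abs_summable_q_prod:
  assumes "\<And>us vs. ss = us @ vs \<Longrightarrow> vs \<noteq> [] \<Longrightarrow> Re (sum_list vs) > length vs"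
  shows "(\<lambda>ns. norm (q_prod q ss ns)) summable_on increasing_lists 0 (length ss)"
proof -
  define ts where "ts = map (\<lambda>s. Re s - 1) ss"
  have sum: "sum_list (map (\<lambda>s. Re s - 1) vs) = Re (sum_list vs) - length vs" for vs
    by (induction vs) auto
  have "sum_list vs > 0" if "ts = us @ vs" "vs \<noteq> []" for us vs
  proof -
    have "vs = drop (length us) ts"
      using that(1) by simp
    then have "vs = map (\<lambda>s. Re s - 1) (drop (length us) ss)"
      by (simp add: ts_def drop_map)
    moreover from this that(2) have "Re (sum_list (drop (length us) ss)) > length (drop (length us) ss)"
      by (intro assms[of "take (length us) ss"]) auto
    ultimately show ?thesis
      by (simp only: sum)
  qed
  then obtain C where "\<forall>N. ((\<lambda>ns. \<Prod>j<length ts. (q powr (ts ! j)) ^ (ns ! j)) has_sum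
      (C * (q powr sum_list ts) ^ N)) (increasing_lists N (length ts))"
    using has_sum_increasing_lists[of ts] by blast
  then have "(\<lambda>ns. \<Prod>j<length ts. (q powr (ts ! j)) ^ (ns ! j)) summable_on increasing_lists 0 (length ts)"
    by (intro has_sum_imp_summable) (rule spec)
  then have summable:
    "(\<lambda>ns. \<Prod>j<length ss. (q powr (Re (ss ! j) - 1)) ^ (ns ! j)) summable_on increasing_lists 0 (length ss)"
    by (simp add: ts_def cong: prod.cong_simp)
  define K where "K = (\<Prod>j<length ss. (1 / (1 - q)) powr \<bar>Re (ss ! j)\<bar>)"
  show ?thesis
  proof (rule summable_on_comparison_test[OF summable_on_cmult_right[OF summable, of K]])
    fix ns assume ns: "ns \<in> increasing_lists 0 (length ss)"
    have "norm (q_prod q ss ns) = (\<Prod>j<length ss. norm (q_term q (ns ! j) (ss ! j)))"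
      by (simp add: q_prod_def prod_norm)
    also have "\<dots> \<le> (\<Prod>j<length ss. (1 / (1 - q)) powr \<bar>Re (ss ! j)\<bar> * (q powr (Re (ss ! j) - 1)) ^ (ns ! j))"
    proof (intro prod_mono conjI norm_q_term_le)
      fix j assume "j \<in> {..<length ss}"
      then have "ns ! j \<in> set ns"
        using ns by (auto simp: increasing_lists_def)
      then show "ns ! j \<ge> 1"
        using ns by (auto simp: increasing_lists_def Suc_le_eq)
    qed auto
    finally show "norm (q_prod q ss ns) \<le> K * (\<Prod>j<length ss. (q powr (Re (ss ! j) - 1)) ^ (ns ! j))"
      by (simp add: K_def prod.distrib)
  qed simp
qed

section \<open>The recursion\<close>

text \<open>\<open>chain_sum k A W N t\<close> is the value of \<open>G\<^sub>q\<^bsup>(a,k+1)\<^esup>\<close> at last variable \<open>s = t + k\<close>, where \<open>A\<close> indexes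
  the \<open>a\<close> smaller summation variables, \<open>W\<close> collects their summands and \<open>N\<close> is the largest of them.\<close>

definition chain_sum :: "nat \<Rightarrow> 'a set \<Rightarrow> ('a \<Rightarrow> complex) \<Rightarrow> ('a \<Rightarrow> nat) \<Rightarrow> complex \<Rightarrow> complex" where
  "chain_sum k A W N t =
    (\<Sum>\<^sub>\<infinity>(x, m)\<in>(SIGMA x:A. {N x<..}). W x * q_term q m t * of_real (h k (m - N x) m))"

context
  fixes A :: "'a set" and W :: "'a \<Rightarrow> complex" and N :: "'a \<Rightarrow> nat" and t :: complex
  assumes summable: "(\<lambda>(x, m). norm (W x * q_term q m t)) summable_on (SIGMA x:A. {N x<..})"
begin

private abbreviation (input) "B \<equiv> (SIGMA x:A. {N x<..})"

private abbreviation (input) V :: "'a \<times> nat \<Rightarrow> complex" where "V \<equiv> \<lambda>y. W (fst y) * q_term q (snd y) t"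

lemma summable_V_mult:
  assumes "\<And>y. y \<in> B \<Longrightarrow> 0 \<le> g y \<and> g y \<le> C"
  shows "(\<lambda>y. norm (V y * of_real (g y))) summable_on B"
  using summable assms
  by (intro norm_summable_on_mult_bounded[where C = C]) (auto simp: case_prod_unfold)

text \<open>The new index \<open>M\<close> lies above \<open>m\<close>. Summing over
  \<open>n\<close> first gives \<open>q_base q (M - m) - q_base q M\<close>, and
  \<open>has_sum_h_tail\<close> then removes \<open>M\<close>.\<close>

lemma chain_sum_first_sums:
  "(\<lambda>n. chain_sum k B (\<lambda>(x, m). W x * q_term q m (t - of_nat (Suc n))) snd (of_nat (n + 2)))
    sums (\<Sum>\<^sub>\<infinity>y\<in>B. V y * of_real (h (Suc k) 1 (snd y)))"
proof -
  define C where "C = (SIGMA y:B. {snd y<..})"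
  define d where "d = (\<lambda>m M. q_base q (M - m) - q_base q M)"
  define r where "r = (\<lambda>m M. q_base q M / q_base q m)"
  have kernel: "((\<lambda>M. d (snd y) M * h k (M - snd y) M) has_sum h (Suc k) 1 (snd y)) {snd y<..}" for y :: "'a \<times> nat"
    unfolding d_def by (rule has_sum_h_tail)
  have d_nonneg: "d m M \<ge> 0" if "m < M" for m M
    using that unfolding d_def by (simp add: q_base_antimono)
  have V: "(\<lambda>y. norm (V y * of_real (h (Suc k) 1 (snd y)))) summable_on B"
    by (rule summable_V_mult[where C = "(1 / (1 - q)) ^ Suc k"]) (intro conjI h_nonneg h_le)
  have kernel_summable: "(\<lambda>(y, M). norm (V y * of_real (d (snd y) M * h k (M - snd y) M))) summable_on C"
    unfolding C_def using d_nonneg h_nonneg by (intro weighted_Sigma_abs_summable[OF kernel _ V]) auto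
  have kernel_total: "((\<lambda>(y, M). V y * of_real (d (snd y) M * h k (M - snd y) M)) has_sum
      (\<Sum>\<^sub>\<infinity>y\<in>B. V y * of_real (h (Suc k) 1 (snd y)))) C"
    unfolding C_def using d_nonneg h_nonneg by (intro weighted_Sigma_has_sum[OF kernel _ V]) auto
  have weights: "(\<lambda>z. norm (V (fst z) * of_real (h k (snd z - snd (fst z)) (snd z)) * of_real (d (snd (fst z)) (snd z)))) summable_on C"
    using kernel_summable by (simp only: case_prod_unfold of_real_mult mult_ac)
  have total: "((\<lambda>z. V (fst z) * of_real (h k (snd z - snd (fst z)) (snd z)) * of_real (d (snd (fst z)) (snd z))) has_sum
      (\<Sum>\<^sub>\<infinity>y\<in>B. V y * of_real (h (Suc k) 1 (snd y)))) C"
    using kernel_total by (simp only: case_prod_unfold of_real_mult mult_ac)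
  have geometric: "(\<lambda>n. r (snd (fst z)) (snd z) * q_base q (snd z) / q ^ snd z * r (snd (fst z)) (snd z) ^ n)
      sums d (snd (fst z)) (snd z)"
    and kernel_nonneg: "r (snd (fst z)) (snd z) * q_base q (snd z) / q ^ snd z * r (snd (fst z)) (snd z) ^ n \<ge> 0"
    if "z \<in> C" for z n
  proof -
    define m where "m = snd (fst z)"
    define M where "M = snd z"
    have m: "1 \<le> m" "m < M"
      using that by (auto simp: C_def m_def M_def)
    have r: "0 \<le> r m M" "r m M < 1"
      using q_base_ratio(1)[OF m] q_base_nonneg by (auto simp: r_def)
    have "(\<lambda>n. r m M * q_base q M / q ^ M * r m M ^ n) sums (r m M * q_base q M / q ^ M * (1 / (1 - r m M)))"
      using r by (intro sums_mult geometric_sums) auto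
    also have "r m M * q_base q M / q ^ M * (1 / (1 - r m M)) = r m M * q_base q M / (1 - r m M) / q ^ M"
      by simp
    also have "\<dots> = d m M"
      unfolding r_def q_base_ratio(3)[OF m] d_def using q by simp
    finally show "(\<lambda>n. r (snd (fst z)) (snd z) * q_base q (snd z) / q ^ snd z * r (snd (fst z)) (snd z) ^ n)
      sums d (snd (fst z)) (snd z)"
      by (simp add: m_def M_def)
    show "r (snd (fst z)) (snd z) * q_base q (snd z) / q ^ snd z * r (snd (fst z)) (snd z) ^ n \<ge> 0"
      using r q q_base_nonneg by (simp add: m_def M_def)
  qed
  have "(\<lambda>n. \<Sum>\<^sub>\<infinity>z\<in>C. V (fst z) * of_real (h k (snd z - snd (fst z)) (snd z)) *
      of_real (r (snd (fst z)) (snd z) * q_base q (snd z) / q ^ snd z * r (snd (fst z)) (snd z) ^ n))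
    sums (\<Sum>\<^sub>\<infinity>z\<in>C. V (fst z) * of_real (h k (snd z - snd (fst z)) (snd z)) * of_real (d (snd (fst z)) (snd z)))"
    by (rule weighted_infsum_sums[OF geometric kernel_nonneg weights])
  moreover have "(\<Sum>\<^sub>\<infinity>z\<in>C. V (fst z) * of_real (h k (snd z - snd (fst z)) (snd z)) *
      of_real (r (snd (fst z)) (snd z) * q_base q (snd z) / q ^ snd z * r (snd (fst z)) (snd z) ^ n)) =
    chain_sum k B (\<lambda>(x, m). W x * q_term q m (t - of_nat (Suc n))) snd (of_nat (n + 2))" for n
    unfolding chain_sum_def C_def[symmetric]
  proof (rule infsum_cong)
    fix z assume z: "z \<in> C"
    obtain x m M where [simp]: "z = ((x, m), M)"
      by (metis prod.exhaust)
    have m: "1 \<le> m" "1 \<le> M" "q_base q m > 0"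
      using z q_base_pos[of m] by (auto simp: C_def)
    \<comment> \<open>The surplus of one power of \<open>q_base q M\<close> over the power of
      \<open>q_base q m\<close> in \<open>e2\<close> leaves
      \<open>r ^ (n + 1) * q_base q M / q ^ M\<close>.\<close>
    have e1: "q_term q M (of_nat (n + 2)) = of_real (q_base q M ^ (n + 2) / q ^ M)"
      using q_term_add_nat[OF m(2), of 0 "n + 2"] q_term_0[OF m(2)] by simp
    have e2: "q_term q m (t - of_nat (Suc n)) = q_term q m t / of_real (q_base q m ^ Suc n)"
      by (rule q_term_diff_nat[OF m(1)])
    show "V (fst z) * of_real (h k (snd z - snd (fst z)) (snd z)) *
      of_real (r (snd (fst z)) (snd z) * q_base q (snd z) / q ^ snd z * r (snd (fst z)) (snd z) ^ n) =
      (case z of (y, M) \<Rightarrow> (case y of (x, m) \<Rightarrow> W x * q_term q m (t - of_nat (Suc n))) *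
        q_term q M (of_nat (n + 2)) * of_real (h k (M - snd y) M))"
      unfolding \<open>z = ((x, m), M)\<close> fst_conv snd_conv prod.case e1 e2
      using m(3) q by (simp add: r_def power_divide field_simps)
  qed
  ultimately show ?thesis
    by (simp only: infsumI[OF total])
qed

text \<open>Here the exponent \<open>t\<close> sits at the largest index \<open>M\<close>, and the
  new index \<open>m\<close> is inserted between \<open>N x\<close> and \<open>M\<close>. The series
  over \<open>n\<close> gives \<open>q_base q (M - m)\<close>, and the finite sum over
  \<open>m\<close> is \<open>sum_h_initial\<close>.\<close>

lemma chain_sum_second_sums:
  "(\<lambda>n. chain_sum k B (\<lambda>(x, m). W x * q_term q m (- of_nat n)) snd (t + of_nat (Suc n)))
    sums (\<Sum>\<^sub>\<infinity>y\<in>B. V y * of_real (h (Suc k) 1 (snd y) - h (Suc k) (snd y - N (fst y)) (snd y)))"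
proof -
  define C where "C = (SIGMA y:B. {snd y<..})"
  define D where "D = (SIGMA y:B. {N (fst y)<..<snd y})"
  define d where "d = (\<lambda>m M. q_base q (M - m))"
  define r where "r = (\<lambda>m M. q_base q M / q_base q m)"
  have kernel: "((\<lambda>m. d m (snd y) * h k (snd y - m) (snd y)) has_sum
      (h (Suc k) 1 (snd y) - h (Suc k) (snd y - N (fst y)) (snd y))) {N (fst y)<..<snd y}" if "y \<in> B" for y
    using that sum_h_initial[of "N (fst y)" "snd y" k] by (intro has_sum_finiteI) (auto simp: d_def)
  have d_nonneg: "d m M \<ge> 0" for m M
    by (simp add: d_def q_base_nonneg)
  have g: "0 \<le> h (Suc k) 1 (snd y) - h (Suc k) (snd y - N (fst y)) (snd y) \<and>
      h (Suc k) 1 (snd y) - h (Suc k) (snd y - N (fst y)) (snd y) \<le> (1 / (1 - q)) ^ Suc k" if "y \<in> B" for y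
  proof
    show "0 \<le> h (Suc k) 1 (snd y) - h (Suc k) (snd y - N (fst y)) (snd y)"
      using has_sum_nonneg[OF kernel[OF that]] d_nonneg h_nonneg by simp
    show "h (Suc k) 1 (snd y) - h (Suc k) (snd y - N (fst y)) (snd y) \<le> (1 / (1 - q)) ^ Suc k"
      using h_le[of "Suc k" 1 "snd y"] h_nonneg[of "Suc k" "snd y - N (fst y)" "snd y"] by linarith
  qed
  have V: "(\<lambda>y. norm (V y * of_real (h (Suc k) 1 (snd y) - h (Suc k) (snd y - N (fst y)) (snd y)))) summable_on B"
    by (rule summable_V_mult) (rule g)
  have kernel_summable: "(\<lambda>(y, m). norm (V y * of_real (d m (snd y) * h k (snd y - m) (snd y)))) summable_on D"
    unfolding D_def using d_nonneg h_nonneg by (intro weighted_Sigma_abs_summable[OF kernel _ V]) auto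
  have kernel_total: "((\<lambda>(y, m). V y * of_real (d m (snd y) * h k (snd y - m) (snd y))) has_sum
      (\<Sum>\<^sub>\<infinity>y\<in>B. V y * of_real (h (Suc k) 1 (snd y) - h (Suc k) (snd y - N (fst y)) (snd y)))) D"
    unfolding D_def using d_nonneg h_nonneg by (intro weighted_Sigma_has_sum[OF kernel _ V]) auto
  have weights: "(\<lambda>z. norm (V (fst z) * of_real (h k (snd (fst z) - snd z) (snd (fst z))) * of_real (d (snd z) (snd (fst z))))) summable_on D"
    using kernel_summable by (simp only: case_prod_unfold of_real_mult mult_ac)
  have total: "((\<lambda>z. V (fst z) * of_real (h k (snd (fst z) - snd z) (snd (fst z))) * of_real (d (snd z) (snd (fst z)))) has_sum
      (\<Sum>\<^sub>\<infinity>y\<in>B. V y * of_real (h (Suc k) 1 (snd y) - h (Suc k) (snd y - N (fst y)) (snd y)))) D"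
    using kernel_total by (simp only: case_prod_unfold of_real_mult mult_ac)
  have geometric: "(\<lambda>n. q_base q (snd (fst z)) / q ^ snd z * r (snd z) (snd (fst z)) ^ n)
      sums d (snd z) (snd (fst z))"
    and kernel_nonneg: "q_base q (snd (fst z)) / q ^ snd z * r (snd z) (snd (fst z)) ^ n \<ge> 0"
    if "z \<in> D" for z n
  proof -
    define m where "m = snd z"
    define M where "M = snd (fst z)"
    have m: "1 \<le> m" "m < M"
      using that by (auto simp: D_def m_def M_def)
    have r: "0 \<le> r m M" "r m M < 1"
      using q_base_ratio(1)[OF m] q_base_nonneg by (auto simp: r_def)
    have "(\<lambda>n. q_base q M / q ^ m * r m M ^ n) sums (q_base q M / q ^ m * (1 / (1 - r m M)))"
      using r by (intro sums_mult geometric_sums) auto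
    also have "q_base q M / q ^ m * (1 / (1 - r m M)) = q_base q M / (1 - r m M) / q ^ m"
      by simp
    also have "\<dots> = d m M"
      unfolding r_def q_base_ratio(2)[OF m] d_def using q by simp
    finally show "(\<lambda>n. q_base q (snd (fst z)) / q ^ snd z * r (snd z) (snd (fst z)) ^ n)
      sums d (snd z) (snd (fst z))"
      by (simp add: m_def M_def)
    show "q_base q (snd (fst z)) / q ^ snd z * r (snd z) (snd (fst z)) ^ n \<ge> 0"
      using r q q_base_nonneg by (simp add: m_def M_def)
  qed
  have "(\<lambda>n. \<Sum>\<^sub>\<infinity>z\<in>D. V (fst z) * of_real (h k (snd (fst z) - snd z) (snd (fst z))) *
      of_real (q_base q (snd (fst z)) / q ^ snd z * r (snd z) (snd (fst z)) ^ n))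
    sums (\<Sum>\<^sub>\<infinity>z\<in>D. V (fst z) * of_real (h k (snd (fst z) - snd z) (snd (fst z))) * of_real (d (snd z) (snd (fst z))))"
    by (rule weighted_infsum_sums[OF geometric kernel_nonneg weights])
  moreover have "(\<Sum>\<^sub>\<infinity>z\<in>D. V (fst z) * of_real (h k (snd (fst z) - snd z) (snd (fst z))) *
      of_real (q_base q (snd (fst z)) / q ^ snd z * r (snd z) (snd (fst z)) ^ n)) =
    chain_sum k B (\<lambda>(x, m). W x * q_term q m (- of_nat n)) snd (t + of_nat (Suc n))" for n
    unfolding chain_sum_def C_def[symmetric]
  \<comment> \<open>\<open>chain_sum\<close> adds \<open>M\<close> last, whereas here
    \<open>m\<close> is summed inside for fixed \<open>M\<close>, so the two indices trade
    places.\<close>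
  proof (rule infsum_reindex_bij_witness[where i = "\<lambda>((x, m), M). ((x, M), m)" and j = "\<lambda>((x, M), m). ((x, m), M)"])
    fix z assume z: "z \<in> D"
    obtain x m M where [simp]: "z = ((x, M), m)"
      by (metis prod.exhaust)
    have m: "1 \<le> m" "1 \<le> M" "q_base q m > 0"
      using z q_base_pos[of m] by (auto simp: D_def)
    have e1: "q_term q M (t + of_nat (Suc n)) = q_term q M t * of_real (q_base q M ^ Suc n)"
      by (rule q_term_add_nat[OF m(2)])
    have e2: "q_term q m (- of_nat n) = 1 / of_real (q ^ m) / of_real (q_base q m ^ n)"
      using q_term_diff_nat[OF m(1), of 0 n] q_term_0[OF m(1)] by simp
    show "(case case z of (y, m) \<Rightarrow> (case y of (x, M) \<Rightarrow> \<lambda>m. ((x, m), M)) m of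
        (y, M) \<Rightarrow> (case y of (x, m) \<Rightarrow> W x * q_term q m (- of_nat n)) *
        q_term q M (t + of_nat (Suc n)) * of_real (h k (M - snd y) M)) =
      V (fst z) * of_real (h k (snd (fst z) - snd z) (snd (fst z))) *
      of_real (q_base q (snd (fst z)) / q ^ snd z * r (snd z) (snd (fst z)) ^ n)"
      unfolding \<open>z = ((x, M), m)\<close> fst_conv snd_conv prod.case e1 e2
      using m(3) q by (simp add: r_def power_divide field_simps)
  qed (auto simp: C_def D_def)
  ultimately show ?thesis
    by (simp only: infsumI[OF total])
qed

text \<open>Both series become sums over the same set \<open>B\<close>, and the parts with
  \<open>h (Suc k) 1\<close> cancel. The shifts come from \<open>s = t + Suc k\<close> and index
  \<open>k + 2\<close> in the recursion for \<open>G_q\<close>.\<close>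

lemma chain_sum_Suc:
  "chain_sum (Suc k) A W N t =
    (\<Sum>n. chain_sum k B (\<lambda>(x, m). W x * q_term q m (t - of_nat (Suc n))) snd (of_nat (n + 2))) -
    (\<Sum>n. chain_sum k B (\<lambda>(x, m). W x * q_term q m (- of_nat n)) snd (t + of_nat (Suc n)))"
proof -
  let ?f = "\<lambda>y. V y * of_real (h (Suc k) 1 (snd y))"
  let ?g = "\<lambda>y. V y * of_real (h (Suc k) (snd y - N (fst y)) (snd y))"
  have f: "?f summable_on B" and g: "?g summable_on B"
    by (rule abs_summable_summable, rule summable_V_mult[where C = "(1 / (1 - q)) ^ Suc k"],
        intro conjI h_nonneg h_le)+
  have "(\<Sum>\<^sub>\<infinity>y\<in>B. V y * of_real (h (Suc k) 1 (snd y) - h (Suc k) (snd y - N (fst y)) (snd y))) =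
      infsum ?f B - infsum ?g B"
    using infsumI[OF has_sum_add[OF has_sum_infsum[OF f] has_sum_uminusI[OF has_sum_infsum[OF g]]]]
    by (simp only: of_real_diff right_diff_distrib flip: diff_conv_add_uminus)
  moreover have "chain_sum (Suc k) A W N t = infsum ?g B"
    by (simp add: chain_sum_def case_prod_unfold del: hom_sym.simps)
  ultimately show ?thesis
    unfolding sums_unique[OF chain_sum_first_sums, symmetric] sums_unique[OF chain_sum_second_sums, symmetric]
    by (simp del: hom_sym.simps)
qed

end

text \<open>Translates the longer lists in the recursive calls of \<open>G_q\<close> into the pairs
  that \<open>chain_sum_Suc\<close> produces.\<close>

lemma chain_sum_snoc:
  "chain_sum k (increasing_lists 0 (Suc (length ss))) (q_prod q (ss @ [s])) (\<lambda>ns. last (0 # ns)) t =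
    chain_sum k (SIGMA ns:increasing_lists 0 (length ss). {last (0 # ns)<..})
      (\<lambda>(ns, m). q_prod q ss ns * q_term q m s) snd t"
  (is "chain_sum k ?L _ _ _ = chain_sum k ?B _ _ _")
proof -
  have "bij_betw (\<lambda>(y, M). ((\<lambda>(ns, m). ns @ [m]) y, M)) (SIGMA y:?B. {snd y<..}) (SIGMA ns:?L. {last (0 # ns)<..})"
  proof -
    have L: "?L = (\<lambda>(ns, m). ns @ [m]) ` ?B"
      using bij_betw_imp_surj_on[OF bij_betw_increasing_lists_snoc] by metis
    show ?thesis
      unfolding L bij_betw_def by (auto simp: inj_on_def image_iff)
  qed
  then show ?thesis
    unfolding chain_sum_def
    by (subst infsum_reindex_bij_betw[symmetric]) (auto intro!: infsum_cong simp: q_prod_snoc increasing_lists_def)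
qed

text \<open>The hypothesis is the domain of \<open>G_q\<close>, with \<open>vs = []\<close> encoding
  the condition on \<open>s\<close> alone. The induction varies \<open>ss\<close> and
  \<open>s\<close>, as each recursive call lengthens the list.\<close>

lemma G_q_eq_chain_sum:
  assumes "\<And>us vs. ss = us @ vs \<Longrightarrow> Re (s + sum_list vs) > real (length vs + Suc k)"
  shows "G_q q (Suc k) ss s =
    chain_sum k (increasing_lists 0 (length ss)) (q_prod q ss) (\<lambda>ns. last (0 # ns)) (s - of_nat k)"
  using assms
proof (induction k arbitrary: ss s)
  case 0
  have "zeta_q q (ss @ [s]) = (\<Sum>\<^sub>\<infinity>ns\<in>increasing_lists 0 (Suc (length ss)). q_prod q (ss @ [s]) ns)"
    by (simp add: zeta_q_eq)
  also have "\<dots> = chain_sum 0 (increasing_lists 0 (length ss)) (q_prod q ss) (\<lambda>ns. last (0 # ns)) s"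
    unfolding chain_sum_def
    by (subst infsum_reindex_bij_betw[OF bij_betw_increasing_lists_snoc, symmetric])
      (auto intro!: infsum_cong simp: q_prod_snoc increasing_lists_def)
  finally show ?case by simp
next
  case (Suc k)
  let ?t = "s - of_nat (Suc k)"
  let ?L = "increasing_lists 0 (length ss)"
  let ?B = "SIGMA ns:?L. {last (0 # ns)<..}"
  \<comment> \<open>In both recursive calls the appended variable and the last one add up to
    \<open>s\<close>. Nonempty suffixes therefore inherit their condition, and only the last
    variable needs a check.\<close>
  have IH: "G_q q (Suc k) (ss @ [s']) s'' = chain_sum k ?B (\<lambda>(ns, m). q_prod q ss ns * q_term q m s') snd (s'' - of_nat k)"
    if "s' + s'' = s" "Re s'' > real (Suc k)" for s' s''
  proof -
    have "Re (s'' + sum_list vs) > real (length vs + Suc k)" if eq: "ss @ [s'] = us @ vs" for us vs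
    proof (cases vs rule: rev_cases)
      case Nil
      then show ?thesis using that \<open>Re s'' > real (Suc k)\<close> by simp
    next
      case (snoc vs' v)
      with eq have "v = s'" "ss = us @ vs'"
        by auto
      with Suc.prems[of us vs'] snoc \<open>s' + s'' = s\<close> show ?thesis
        by (auto simp: algebra_simps)
    qed
    from Suc.IH[OF this] show ?thesis
      using chain_sum_snoc[of k ss s' "s'' - of_nat k"] by simp
  qed
  have s: "Re s > real (Suc (Suc k))"
    using Suc.prems[of ss "[]"] by simp
  have first: "G_q q (Suc k) (ss @ [s - of_nat n - of_nat (Suc (Suc k))]) (of_nat n + of_nat (Suc (Suc k))) =
      chain_sum k ?B (\<lambda>(ns, m). q_prod q ss ns * q_term q m (?t - of_nat (Suc n))) snd (of_nat (n + 2))" for n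
  proof -
    have "s - of_nat n - of_nat (Suc (Suc k)) + (of_nat n + of_nat (Suc (Suc k))) = s"
      "Re (of_nat n + of_nat (Suc (Suc k))) > real (Suc k)"
      by simp_all
    note IH[OF this]
    moreover have "s - of_nat n - of_nat (Suc (Suc k)) = ?t - of_nat (Suc n)"
      "of_nat n + of_nat (Suc (Suc k)) - of_nat k = (of_nat (n + 2) :: complex)"
      by simp_all
    ultimately show ?thesis by metis
  qed
  have second: "G_q q (Suc k) (ss @ [- of_nat n]) (s + of_nat n) =
      chain_sum k ?B (\<lambda>(ns, m). q_prod q ss ns * q_term q m (- of_nat n)) snd (?t + of_nat (Suc n))" for n
  proof -
    have "- of_nat n + (s + of_nat n) = s" "Re (s + of_nat n) > real (Suc k)"
      using s by simp_all
    note IH[OF this]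
    moreover have "s + of_nat n - of_nat k = ?t + of_nat (Suc n)"
      by simp
    ultimately show ?thesis by metis
  qed
  \<comment> \<open>Replacing \<open>s\<close> by \<open>s - of_nat (Suc k)\<close> turns the domain
    condition into exactly the region of convergence in one more variable.\<close>
  have "Re (sum_list vs) > real (length vs)" if eq: "ss @ [?t] = us @ vs" and "vs \<noteq> []" for us vs
  proof -
    obtain vs' v where vs: "vs = vs' @ [v]"
      using \<open>vs \<noteq> []\<close> by (metis rev_exhaust)
    with eq have "v = ?t" "ss = us @ vs'"
      by auto
    with Suc.prems[of us vs'] vs show ?thesis
      by (auto simp: algebra_simps)
  qed
  from abs_summable_q_prod[of "ss @ [?t]", OF this]
  have "(\<lambda>ns. norm (q_prod q (ss @ [?t]) ns)) summable_on increasing_lists 0 (Suc (length ss))"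
    by simp
  then have "(\<lambda>(ns, m). norm (q_prod q (ss @ [?t]) (ns @ [m]))) summable_on ?B"
    by (subst (asm) summable_on_reindex_bij_betw[OF bij_betw_increasing_lists_snoc, symmetric])
      (simp add: case_prod_unfold)
  also have "?this \<longleftrightarrow> (\<lambda>(ns, m). norm (q_prod q ss ns * q_term q m ?t)) summable_on ?B"
    by (intro summable_on_cong) (auto simp: q_prod_snoc increasing_lists_def)
  finally show ?case
    unfolding G_q.simps first second by (rule chain_sum_Suc[symmetric])
qed

end

section \<open>The case of no smaller variables\<close>

theorem theorem4:
  fixes q :: real and b :: nat and s :: complex
  assumes "0 < q" and "q < 1" and "b \<ge> 1" and "Re s > real b"
  shows "G_q q b [] s = zeta_q q [s]"
proof -
  have index: "(SIGMA ns:{[] :: nat list}. {last (0 # ns)<..}) = {[]} \<times> {0<..}"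
    by auto
  have independent: "G_q q (Suc k) [] s = (\<Sum>\<^sub>\<infinity>(ns, m)\<in>{[] :: nat list} \<times> {0<..}. q_term q m s)"
    if "Re s > real (Suc k)" for k
  proof -
    have "G_q q (Suc k) [] s = chain_sum q k {[]} (q_prod q []) (\<lambda>ns. last (0 # ns)) (s - of_nat k)"
      using G_q_eq_chain_sum[OF assms(1,2), where ss = "[]" and s = s and k = k] that
      by (simp add: increasing_lists_0)
    also have "\<dots> = (\<Sum>\<^sub>\<infinity>(ns, m)\<in>{[] :: nat list} \<times> {0<..}. q_term q m s)"
      unfolding chain_sum_def[OF assms(1,2)] index
    proof (rule infsum_cong, clarsimp simp: q_prod_def)
      fix m :: nat assume "m > 0"
      \<comment> \<open>The lower bound is the 0 in \<open>last (0 # ns)\<close>, so the range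
        collapses to \<open>m\<close> alone, and \<open>q_base q m ^ k\<close> undoes the shift of
        the exponent by \<open>k\<close>.\<close>
      then show "q_term q m (s - of_nat k) * of_real (hom_sym (q_base q) k m m) = q_term q m s"
        using q_term_add_nat[OF assms(1,2), of m "s - of_nat k" k] by (simp add: hom_sym_singleton)
    qed
    finally show ?thesis .
  qed
  obtain k where "b = Suc k"
    using assms(3) by (cases b) auto
  \<comment> \<open>The common value does not involve \<open>k\<close>; comparison with
    \<open>k = 0\<close> reaches the base case of the recursion.\<close>
  then have "G_q q b [] s = G_q q (Suc 0) [] s"
    using independent[of k] independent[of 0] assms(4) by simp
  then show ?thesis by simp
qed

end
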